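(* Let $d\ge2$, let $\varphi=(\varphi_1,\ldots,\varphi_d)\in\mathbb{Z}[T]^d$ be $d$ distinct nonconstant polynomials whose Wronskian $W(T;\varphi)$ does not vanish identically, and let $(a_n)_{n=1}^\infty$ be a sequence of complex numbers with $a_n=n^{o(1)}$. Then for almost all $\mathbf{u}=(u_1,\ldots,u_d)\in[0,1)^d$ one has $$\Big|\sum_{n=1}^N a_n\,\mathbf{e}\big(u_1\varphi_1(n)+\ldots+u_d\varphi_d(n)\big)\Big|\le N^{1/2+o(1)},\qquad N\to\infty.$$ That is, for almost all $\mathbf{u}$ and every $\varepsilon>0$ there is $N_0$ (possibly depending on $\mathbf{u}$ and $\varepsilon$) such that the left-hand side is at most $N^{1/2+\varepsilon}$ for all $N\ge N_0$.
   Context: Notation: $\mathbf{e}(x)=\exp(2\pi i x)$. The Wronskian is $W(T;\varphi)=\det\big(\varphi_i^{(j-1)}(T)\big)_{i,j=1}^d$, where $\varphi_i^{(m)}$ is the $m$-th derivative of $\varphi_i$ and $\varphi_i^{(0)}=\varphi_i$. The condition $a_n=n^{o(1)}$ means that for every $\varepsilon>0$, $|a_n|\le n^\varepsilon$ for all sufficiently large $n$. "Almost all" is with respect to $d$-dimensional Lebesgue measure. *)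

theory Defs
  imports "HOL-Analysis.Analysis" "Jordan_Normal_Form.Determinant"
begin

text \<open>Families \<open>\<phi>\<^sub>1, \<dots>, \<phi>\<^sub>d\<close> are indexed by the natural numbers below \<open>d\<close>; values
  at indices from \<open>d\<close> on are irrelevant. Points of d-dimensional space are functions on \<open>{..<d}\<close>
  (extensional, value \<open>undefined\<close> elsewhere).\<close>

text \<open>The Wronskian as a polynomial in T: the determinant over the ring of integer polynomials,
  formed with the formal derivative; the derivative orders are \<open>0, \<dots>, d - 1\<close>.
  The name is qualified because the Analysis library also has a \<open>det\<close>, for type-indexed matrices.\<close>

definition wronskian :: "nat \<Rightarrow> (nat \<Rightarrow> int poly) \<Rightarrow> int poly" where
  "wronskian d \<phi> = Determinant.det (mat d d (\<lambda>(i, j). (pderiv ^^ j) (\<phi> i)))"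

definition e_char :: "real \<Rightarrow> complex" where
  "e_char x = exp (2 * complex_of_real pi * \<i> * complex_of_real x)"

definition weyl_sum ::
  "nat \<Rightarrow> (nat \<Rightarrow> int poly) \<Rightarrow> (nat \<Rightarrow> complex) \<Rightarrow> (nat \<Rightarrow> real) \<Rightarrow> nat \<Rightarrow> complex" where
  "weyl_sum d \<phi> a u N =
     (\<Sum>n=1..N. a n * e_char (\<Sum>i<d. u i * real_of_int (poly (\<phi> i) (int n))))"

text \<open>Lebesgue measure in dimension \<open>d\<close>, with \<open>d\<close> a term rather than a type.\<close>

definition lebesgue_space :: "nat \<Rightarrow> (nat \<Rightarrow> real) measure" where
  "lebesgue_space d = completion (PiM {..<d} (\<lambda>_. lborel))"

end

theory Submission
  imports Defs "HOL-Real_Asymp.Real_Asymp"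
begin

text \<open>A nonconstant polynomial takes each value boundedly often.
  Hence the functions \<open>a\<^sub>n e(u\<^sub>1\<phi>\<^sub>1(n) + \<dots> + u\<^sub>d\<phi>\<^sub>d(n))\<close> are
  orthogonal on the unit cube up to a constant factor. The Rademacher--Menshov device
  decomposes each partial sum with \<open>N < 2^k\<close> into at most \<open>k\<close> dyadic blocks;
  this bounds the mean square of the maximal partial sum by
  \<open>k\<^sup>2 2^(k (1 + o(1)))\<close>, and summation over \<open>k\<close> gives the estimate almost everywhere.\<close>

section \<open>Dyadic decomposition of partial sums\<close>

text \<open>Clearing the binary digits of \<open>N\<close> one at a time, lowest first, leads from
  \<open>N\<close> to 0 in \<open>k\<close> steps, and each step removes either nothing or a single
  dyadic block. Replacing that block by the square root of the sum over all blocks of its length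
  makes the right-hand side independent of \<open>N\<close>, so it bounds the maximal partial
  sum.\<close>

lemma sum_dyadic_telescope:
  fixes g :: "nat \<Rightarrow> 'a::real_normed_vector"
  assumes "N < 2 ^ k"
  shows "norm (\<Sum>n<N. g n) \<le>
    (\<Sum>j<k. sqrt (\<Sum>i<2^(k-j). (norm (\<Sum>n=i*2^j..<i*2^j+2^j. g n))\<^sup>2))"
proof -
  \<comment> \<open>\<open>M j\<close> is \<open>N\<close> with its lowest \<open>j\<close> binary
    digits set to zero.\<close>
  define M where "M j = N div 2 ^ j * 2 ^ j" for j
  define T where "T j i = (\<Sum>n=i*2^j..<i*2^j+2^j. g n)" for i j :: nat
  define L where "L j = sqrt (\<Sum>i<2^(k-j). (norm (T j i))\<^sup>2)" for j
  have L0: "0 \<le> L j" for j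
    unfolding L_def by (simp add: sum_nonneg)
  have step: "norm ((\<Sum>n<M j. g n) - (\<Sum>n<M (Suc j). g n)) \<le> L j" if "j < k" for j
  proof -
    define q where "q = N div 2 ^ j"
    have Mj: "M j = q * 2 ^ j" by (simp add: M_def q_def)
    have MS: "M (Suc j) = (q div 2) * 2 * 2 ^ j"
      by (simp add: M_def q_def flip: div_mult2_eq add: mult.commute)
    have "N < 2 ^ (k - j) * 2 ^ j"
      using assms that by (simp flip: power_add)
    then have q: "q < 2 ^ (k - j)"
      by (simp add: q_def less_mult_imp_div_less)
    show ?thesis
    proof (cases "even q")
      case True
      then show ?thesis using Mj MS L0[of j] by simp
    next
      case False
      \<comment> \<open>Digit \<open>j\<close> of \<open>N\<close> is 1 here. Clearing it removes
        the block of length \<open>2^j\<close> with the even index \<open>2 * r = q - 1\<close>,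
        which is in range because \<open>q < 2^(k-j)\<close>.\<close>
      then obtain r where r: "q = 2 * r + 1" by (auto elim: oddE)
      have a: "M (Suc j) = (2 * r) * 2 ^ j" and b: "M j = (2 * r) * 2 ^ j + 2 ^ j"
        using Mj MS r by (simp_all add: algebra_simps)
      have "(\<Sum>n<M j. g n) = (\<Sum>n<M (Suc j). g n) + (\<Sum>n=M (Suc j)..<M j. g n)"
        using a b sum.atLeastLessThan_concat[of 0 "M (Suc j)" "M j" g]
        by (simp add: lessThan_atLeast0)
      then have eq: "(\<Sum>n<M j. g n) - (\<Sum>n<M (Suc j). g n) = T j (2 * r)"
        by (simp add: T_def a b)
      have "(norm (T j (2 * r)))\<^sup>2 \<le> (\<Sum>i<2^(k-j). (norm (T j i))\<^sup>2)"
        by (rule member_le_sum) (use q r in auto)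
      then show ?thesis
        unfolding eq L_def by (rule real_le_rsqrt)
    qed
  qed
  have "M 0 = N" "M k = 0"
    using assms by (simp_all add: M_def)
  then have "(\<Sum>n<N. g n) = (\<Sum>j<k. (\<Sum>n<M j. g n) - (\<Sum>n<M (Suc j). g n))"
    using sum_lessThan_telescope'[of "\<lambda>j. \<Sum>n<M j. g n" k] by simp
  also have "norm \<dots> \<le> (\<Sum>j<k. L j)"
    by (rule sum_norm_le) (use step in auto)
  finally show ?thesis by (simp add: L_def T_def)
qed

text \<open>Cauchy-Schwarz over the \<open>k\<close> scales costs a factor \<open>k\<close> and
  leaves only squared norms of block sums, which can be integrated term by term.\<close>

lemma norm_sum_squared_le_dyadic:
  fixes g :: "nat \<Rightarrow> 'a::real_normed_vector"
  assumes "N < 2 ^ k"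
  shows "(norm (\<Sum>n<N. g n))\<^sup>2 \<le>
    real k * (\<Sum>j<k. \<Sum>i<2^(k-j). (norm (\<Sum>n=i*2^j..<i*2^j+2^j. g n))\<^sup>2)"
proof -
  let ?L = "\<lambda>j. sqrt (\<Sum>i<2^(k-j). (norm (\<Sum>n=i*2^j..<i*2^j+2^j. g n))\<^sup>2)"
  have "(norm (\<Sum>n<N. g n))\<^sup>2 \<le> (\<Sum>j<k. ?L j)\<^sup>2"
    using sum_dyadic_telescope[OF assms, of g] by (intro power_mono) auto
  also have "\<dots> \<le> (\<Sum>j<k. (?L j)\<^sup>2) * card {..<k}"
    by (rule sum_squared_le_sum_of_squares)
  finally show ?thesis
    by (simp add: sum_nonneg mult.commute)
qed

section \<open>From mean squares to almost everywhere bounds\<close>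

text \<open>By monotone convergence the series of the \<open>V k\<close> has a finite integral, so
  it converges almost everywhere and its terms tend to 0. This takes the place of Chebyshev's
  inequality with Borel-Cantelli.\<close>

lemma AE_tendsto_0_of_summable_nn_integral:
  fixes V :: "nat \<Rightarrow> 'a \<Rightarrow> real"
  assumes [measurable]: "\<And>k. V k \<in> borel_measurable M"
    and V: "\<And>k x. 0 \<le> V k x"
    and I: "\<And>k. (\<integral>\<^sup>+x. ennreal (V k x) \<partial>M) \<le> ennreal (I k)" "\<And>k. 0 \<le> I k" "summable I"
  shows "AE x in M. (\<lambda>k. V k x) \<longlonglongrightarrow> 0"
proof -
  have "(\<integral>\<^sup>+x. (\<Sum>k. ennreal (V k x)) \<partial>M) = (\<Sum>k. \<integral>\<^sup>+x. ennreal (V k x) \<partial>M)"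
    by (rule nn_integral_suminf) measurable
  also have "\<dots> \<le> (\<Sum>k. ennreal (I k))"
    by (intro suminf_le I) auto
  also have "\<dots> = ennreal (\<Sum>k. I k)"
    by (rule suminf_ennreal2) (use I in auto)
  finally have "(\<integral>\<^sup>+x. (\<Sum>k. ennreal (V k x)) \<partial>M) \<noteq> \<infinity>"
    by (auto simp: top_unique)
  then have "AE x in M. (\<Sum>k. ennreal (V k x)) \<noteq> \<infinity>"
    by (intro nn_integral_PInf_AE) measurable
  then show ?thesis
  proof (rule AE_mp, intro AE_I2 impI)
    fix x assume "(\<Sum>k. ennreal (V k x)) \<noteq> \<infinity>"
    then have "summable (\<lambda>k. V k x)"
      using V by (intro summable_suminf_not_top) auto
    then show "(\<lambda>k. V k x) \<longlonglongrightarrow> 0" by (rule summable_LIMSEQ_zero)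
  qed
qed

lemma two_powr_power_commute: "(2 powr s) ^ k = (2 ^ k) powr s" for s :: real
proof -
  have "(2 ^ k) powr s = (2 powr real k) powr s"
    using powr_realpow[of 2 k] by simp
  also have "\<dots> = (2 powr s) ^ k"
    by (simp add: powr_powr powr_power mult.commute)
  finally show ?thesis ..
qed

text \<open>Makes an asymptotic bound uniform: one constant serves for every index below
  \<open>2^k\<close>, and the growth becomes geometric in \<open>k\<close>.\<close>

lemma bigo_imp_bounded_by_power_of_two:
  fixes B :: "nat \<Rightarrow> real"
  assumes "B \<in> O(\<lambda>n. real n powr \<delta>)" "\<delta> > 0"
  obtains C where "C \<ge> 0" "\<And>n k. n < 2 ^ k \<Longrightarrow> B n \<le> C * (2 powr \<delta>) ^ k"
proof -
  obtain c where c: "c > 0" "\<forall>\<^sub>F n in sequentially. norm (B n) \<le> c * norm (real n powr \<delta>)"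
    using assms(1) by (rule landau_o.bigE)
  then obtain m where m: "\<And>n. n \<ge> m \<Longrightarrow> norm (B n) \<le> c * norm (real n powr \<delta>)"
    by (auto simp: eventually_sequentially)
  \<comment> \<open>The sum absorbs the finitely many indices at which the asymptotic bound may
    fail.\<close>
  define C where "C = c + (\<Sum>n<m. \<bar>B n\<bar>)"
  have C: "C \<ge> c" "C \<ge> 0"
    using c(1) by (auto simp: C_def sum_nonneg)
  show thesis
  proof (rule that)
    fix n k :: nat assume n: "n < 2 ^ k"
    have ge1: "1 \<le> (2 powr \<delta>) ^ k"
      using assms(2) by (intro one_le_power ge_one_powr_ge_zero) auto
    show "B n \<le> C * (2 powr \<delta>) ^ k"
    proof (cases "n < m")
      case True
      then have "\<bar>B n\<bar> \<le> (\<Sum>n<m. \<bar>B n\<bar>)"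
        by (intro member_le_sum) auto
      then have "B n \<le> C * 1" using c(1) by (simp add: C_def)
      also have "\<dots> \<le> C * (2 powr \<delta>) ^ k"
        using ge1 C by (intro mult_left_mono) auto
      finally show ?thesis .
    next
      case False
      have "real n \<le> 2 ^ k" using n by (metis less_imp_le of_nat_le_iff of_nat_numeral of_nat_power)
      then have "real n powr \<delta> \<le> (2 ^ k) powr \<delta>"
        using assms(2) by (intro powr_mono2) auto
      also have "\<dots> = (2 powr \<delta>) ^ k"
        by (rule two_powr_power_commute[symmetric])
      finally have "c * real n powr \<delta> \<le> C * (2 powr \<delta>) ^ k"
        using C c(1) by (intro mult_mono) auto
      then show ?thesis using m[of n] False by auto
    qed
  qed (use C in auto)
qed

text \<open>\<open>G k\<close> dominates the squares of all partial sums with fewer than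
  \<open>2^k\<close> terms, and its mean is at most \<open>k^2 * C * (2 * q)^k\<close>. Since
  \<open>q\<close> may be taken arbitrarily close to 1, normalising by a slightly larger geometric
  sequence gives summable means.\<close>

lemma AE_partial_sums_le_powr:
  fixes f :: "nat \<Rightarrow> 'a \<Rightarrow> complex" and B :: "nat \<Rightarrow> real"
  assumes [measurable]: "\<And>n. f n \<in> borel_measurable M"
    and B0: "\<And>n. 0 \<le> B n"
    and quasi_orth: "\<And>A. finite A \<Longrightarrow>
      (\<integral>\<^sup>+x. ennreal ((norm (\<Sum>n\<in>A. f n x))\<^sup>2) \<partial>M) \<le> ennreal (\<Sum>n\<in>A. B n)"
    and B: "\<And>\<delta>. \<delta> > 0 \<Longrightarrow> B \<in> O(\<lambda>n. real n powr \<delta>)"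
    and \<epsilon>: "\<epsilon> > 0"
  shows "AE x in M. \<forall>\<^sub>F N in sequentially. norm (\<Sum>n\<le>N. f n x) \<le> real N powr (1 / 2 + \<epsilon>)"
proof -
  \<comment> \<open>The final exponent \<open>1 + 2 * \<delta>\<close> equals
    \<open>1 + \<epsilon>\<close>, leaving a spare power of \<open>N\<close> to absorb the constant
    factor from \<open>4 * N\<close>.\<close>
  define \<delta> where "\<delta> = \<epsilon> / 2"
  have \<delta>: "\<delta> > 0" using \<epsilon> by (simp add: \<delta>_def)
  define q where "q = 2 powr \<delta>"
  have q: "q > 1" unfolding q_def using \<delta> by simp
  obtain C where C: "C \<ge> 0" "\<And>n k. n < 2 ^ k \<Longrightarrow> B n \<le> C * q ^ k"
    using bigo_imp_bounded_by_power_of_two[OF B[OF \<delta>] \<delta>] unfolding q_def by blast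
  define G where "G k x = real k * (\<Sum>j<k. \<Sum>i<2^(k-j). (norm (\<Sum>n=i*2^j..<i*2^j+2^j. f n x))\<^sup>2)"
    for k x
  \<comment> \<open>One factor \<open>q\<close> cancels the growth of the mean of
    \<open>G k\<close>; the other supplies the geometric decay in \<open>I k\<close>.\<close>
  define V where "V k x = G k x / (2 * q * q) ^ k" for k x
  define I where "I k = C * (real k ^ 2 * (1 / q) ^ k)" for k
  have G_meas [measurable]: "G k \<in> borel_measurable M" for k
    unfolding G_def by measurable
  have G0: "0 \<le> G k x" for k x
    unfolding G_def by (intro mult_nonneg_nonneg sum_nonneg) auto
  have G_int: "(\<integral>\<^sup>+x. ennreal (G k x) \<partial>M) \<le> ennreal (real k ^ 2 * (C * (2 * q) ^ k))" for k
  proof -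
    have "(\<integral>\<^sup>+x. ennreal (G k x) \<partial>M) = ennreal (real k) *
      (\<Sum>j<k. \<Sum>i<2^(k-j). \<integral>\<^sup>+x. ennreal ((norm (\<Sum>n=i*2^j..<i*2^j+2^j. f n x))\<^sup>2) \<partial>M)"
      unfolding G_def
      by (simp add: ennreal_mult sum_nonneg nn_integral_cmult nn_integral_sum flip: sum_ennreal)
    also have "\<dots> \<le> ennreal (real k) * (\<Sum>j<k. \<Sum>i<2^(k-j). ennreal (\<Sum>n=i*2^j..<i*2^j+2^j. B n))"
      by (intro mult_left_mono sum_mono quasi_orth) auto
    also have "\<dots> = ennreal (real k * (\<Sum>j<k. \<Sum>i<2^(k-j). (\<Sum>n=i*2^j..<i*2^j+2^j. B n)))"
      using B0 by (simp add: ennreal_mult sum_nonneg)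
    \<comment> \<open>At every scale the blocks tile the integers below \<open>2^k\<close>, so each
      of the \<open>k\<close> scales contributes the same total.\<close>
    also have "(\<Sum>j<k. \<Sum>i<2^(k-j). (\<Sum>n=i*2^j..<i*2^j+2^j. B n)) = (\<Sum>j<k. \<Sum>n<2^k. B n)"
    proof (rule sum.cong)
      fix j assume "j \<in> {..<k}"
      then have "2 ^ (k - j) * 2 ^ j = (2::nat) ^ k" by (simp flip: power_add)
      then show "(\<Sum>i<2^(k-j). (\<Sum>n=i*2^j..<i*2^j+2^j. B n)) = (\<Sum>n<2^k. B n)"
        by (simp add: sum.nat_group)
    qed simp
    also have "ennreal (real k * (\<Sum>j<k. \<Sum>n<2^k. B n)) \<le> ennreal (real k * (\<Sum>j<k. \<Sum>n<(2::nat)^k. C * q ^ k))"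
      by (intro ennreal_leI mult_left_mono sum_mono C(2)) auto
    also have "real k * (\<Sum>j<k. \<Sum>n<(2::nat)^k. C * q ^ k) = real k ^ 2 * (C * (2 * q) ^ k)"
      by (simp add: power2_eq_square power_mult_distrib)
    finally show ?thesis .
  qed
  have V_int: "(\<integral>\<^sup>+x. ennreal (V k x) \<partial>M) \<le> ennreal (I k)" for k
  proof -
    have "(\<integral>\<^sup>+x. ennreal (V k x) \<partial>M) = (\<integral>\<^sup>+x. ennreal (1 / (2 * q * q) ^ k) * ennreal (G k x) \<partial>M)"
      using q G0 by (intro nn_integral_cong) (simp add: V_def flip: ennreal_mult)
    also have "\<dots> = ennreal (1 / (2 * q * q) ^ k) * (\<integral>\<^sup>+x. ennreal (G k x) \<partial>M)"
      by (rule nn_integral_cmult) measurable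
    also have "\<dots> \<le> ennreal (1 / (2 * q * q) ^ k) * ennreal (real k ^ 2 * (C * (2 * q) ^ k))"
      by (intro mult_left_mono G_int) auto
    also have "\<dots> = ennreal (1 / (2 * q * q) ^ k * (real k ^ 2 * (C * (2 * q) ^ k)))"
      using q C by (simp flip: ennreal_mult)
    also have "1 / (2 * q * q) ^ k * (real k ^ 2 * (C * (2 * q) ^ k)) = I k"
      using q by (simp add: I_def power_mult_distrib field_simps)
    finally show ?thesis .
  qed
  have I_summable: "summable I"
  proof -
    have "(\<lambda>k::nat. real k ^ 2 * (1 / q) ^ k) \<in> O(\<lambda>k. 1 / real k ^ 2)"
      using q by real_asymp
    then have "summable (\<lambda>k::nat. real k ^ 2 * (1 / q) ^ k)"
      by (rule summable_comparison_test_bigo[rotated])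
         (use inverse_power_summable[of 2, where ?'a=real] in \<open>simp add: inverse_eq_divide\<close>)
    then show ?thesis unfolding I_def by (rule summable_mult)
  qed
  have "AE x in M. (\<lambda>k. V k x) \<longlonglongrightarrow> 0"
  proof (rule AE_tendsto_0_of_summable_nn_integral[OF _ _ V_int _ I_summable])
    show "V k \<in> borel_measurable M" for k unfolding V_def by measurable
  qed (use G0 q C in \<open>auto simp: V_def I_def\<close>)
  then show ?thesis
  proof (rule AE_mp, intro AE_I2 impI)
    fix x assume "(\<lambda>k. V k x) \<longlonglongrightarrow> 0"
    then have "\<forall>\<^sub>F k in sequentially. V k x < 1"
      by (rule order_tendstoD) simp
    then obtain k0 where k0: "\<And>k. k \<ge> k0 \<Longrightarrow> V k x < 1"
      by (auto simp: eventually_sequentially)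
    have large: "\<forall>\<^sub>F N in sequentially. (4 * real N) powr (1 + 2 * \<delta>) \<le> real N powr (1 + 2 * \<epsilon>)"
      unfolding \<delta>_def using \<epsilon> by real_asymp
    show "\<forall>\<^sub>F N in sequentially. norm (\<Sum>n\<le>N. f n x) \<le> real N powr (1 / 2 + \<epsilon>)"
      using large eventually_ge_at_top[of "2 ^ k0"]
    proof eventually_elim
      case (elim N)
      have N1: "N \<ge> 1" using elim(2) by (meson le_trans one_le_numeral one_le_power)
      \<comment> \<open>The sum up to \<open>N\<close> inclusive has \<open>Suc N\<close> terms,
        hence the shift. The choice gives \<open>2^k \<le> 2 * (N + 1) \<le> 4 * N\<close>, the last
        step by \<open>N \<ge> 1\<close>.\<close>
      obtain m where m: "2 ^ m \<le> Suc N" "Suc N < 2 ^ (m + 1)"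
        using ex_power_ivl1[of 2 "Suc N"] by auto
      define k where "k = m + 1"
      have "(2::nat) ^ k0 < 2 ^ k" using elim(2) m by (simp add: k_def)
      then have "k \<ge> k0" by (simp add: less_imp_le)
      then have "G k x \<le> (2 * q * q) ^ k"
        using k0[of k] q by (simp add: V_def field_simps)
      also have "\<dots> = (2 ^ k) powr (1 + 2 * \<delta>)"
      proof -
        have "2 * q * q = 2 powr (1 + 2 * \<delta>)"
          unfolding q_def mult_2 powr_add by simp
        then show ?thesis
          by (simp only: two_powr_power_commute)
      qed
      also have "\<dots> \<le> (4 * real N) powr (1 + 2 * \<delta>)"
      proof (rule powr_mono2)
        have "2 ^ k \<le> 4 * N" using m N1 by (simp add: k_def)
        then show "2 ^ k \<le> 4 * real N"
          by (metis of_nat_le_iff of_nat_mult of_nat_numeral of_nat_power)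
      qed (use \<delta> in auto)
      also have "\<dots> \<le> real N powr (1 + 2 * \<epsilon>)" by (rule elim(1))
      also have "\<dots> = (real N powr (1 / 2 + \<epsilon>))\<^sup>2"
        by (simp add: power2_eq_square flip: powr_add)
      finally have "G k x \<le> (real N powr (1 / 2 + \<epsilon>))\<^sup>2" .
      moreover have "(norm (\<Sum>n\<le>N. f n x))\<^sup>2 \<le> G k x"
        using norm_sum_squared_le_dyadic[of "Suc N" k "\<lambda>n. f n x"] m
        unfolding G_def k_def by (simp add: lessThan_Suc_atMost)
      ultimately show ?case
        by (meson order_trans power2_le_imp_le powr_ge_zero)
    qed
  qed
qed

section \<open>Orthogonality of characters on the unit cube\<close>

text \<open>For nonzero \<open>k\<close> the antiderivative \<open>exp (c * x) / c\<close> takes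
  equal values at 0 and 1, because \<open>exp c = 1\<close>.\<close>

lemma has_bochner_integral_e_char:
  "has_bochner_integral lborel (\<lambda>x. indicator {0..1} x *\<^sub>R e_char (x * real_of_int k)) (of_bool (k = 0))"
proof (cases "k = 0")
  case True
  have "has_bochner_integral lborel (\<lambda>x. indicator {0..1::real} x *\<^sub>R (1::complex))
     (measure lborel {0..1::real} *\<^sub>R 1)"
    by (intro has_bochner_integral_scaleR_left has_bochner_integral_real_indicator) auto
  then show ?thesis using True by (simp add: e_char_def)
next
  case False
  define c where "c = 2 * complex_of_real pi * \<i> * of_int k"
  have c: "c \<noteq> 0" using False by (simp add: c_def)
  have e: "e_char (x * real_of_int k) = exp (c * of_real x)" for x
    by (simp add: e_char_def c_def mult_ac)
  have "has_bochner_integral lborel (\<lambda>x. indicator {0..1} x *\<^sub>R exp (c * of_real x))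
     (exp (c * of_real 1) / c - exp (c * of_real 0) / c)"
  proof (rule has_bochner_integral_FTC_Icc)
    show "((\<lambda>x. exp (c * of_real x) / c) has_vector_derivative exp (c * of_real x)) (at x within {0..1})"
      for x :: real
      using c by (auto intro!: derivative_eq_intros has_vector_derivative_real_field)
  qed (auto intro!: continuous_intros)
  moreover have "exp c = 1"
    using exp_integer_2pi[of "of_int k"] by (simp add: c_def mult_ac)
  ultimately show ?thesis using False by (simp add: e)
qed

lemma e_char_sum: "e_char (\<Sum>i\<in>A. x i) = (\<Prod>i\<in>A. e_char (x i))"
  by (induction A rule: infinite_finite_induct)
     (simp_all add: e_char_def exp_add distrib_left)

lemma e_char_mult_cnj: "e_char x * cnj (e_char y) = e_char (x - y)"
  by (simp add: e_char_def exp_cnj algebra_simps flip: exp_add)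

text \<open>A character cut off to the closed unit cube, so that integrals run over the whole
  product space. The product form lets Fubini split the integral into one-dimensional
  factors.\<close>

definition box_char :: "nat \<Rightarrow> (nat \<Rightarrow> int) \<Rightarrow> (nat \<Rightarrow> real) \<Rightarrow> complex" where
  "box_char d k u = (\<Prod>i<d. indicator {0..1} (u i) *\<^sub>R e_char (u i * real_of_int (k i)))"

lemma borel_measurable_e_char [measurable]: "e_char \<in> borel_measurable borel"
  unfolding e_char_def by measurable

lemma borel_measurable_box_char [measurable]:
  "box_char d k \<in> borel_measurable (PiM {..<d} (\<lambda>_. lborel))"
  unfolding box_char_def by measurable

lemma has_bochner_integral_box_char:
  "has_bochner_integral (PiM {..<d} (\<lambda>_. lborel)) (box_char d k) (of_bool (\<forall>i<d. k i = 0))"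
proof -
  interpret product_sigma_finite "\<lambda>_::nat. lborel :: real measure" ..
  let ?f = "\<lambda>i x. indicator {0..1} x *\<^sub>R e_char (x * real_of_int (k i))"
  have f: "integrable lborel (?f i)" "integral\<^sup>L lborel (?f i) = of_bool (k i = 0)" for i
    using has_bochner_integral_e_char[of "k i"] by (auto simp: has_bochner_integral_iff)
  have "integrable (PiM {..<d} (\<lambda>_. lborel)) (box_char d k)"
    unfolding box_char_def by (rule product_integrable_prod) (use f in auto)
  moreover have "integral\<^sup>L (PiM {..<d} (\<lambda>_. lborel)) (box_char d k) = (\<Prod>i<d. of_bool (k i = 0))"
    unfolding box_char_def by (subst product_integral_prod) (use f in auto)
  moreover have "(\<Prod>i<d. of_bool (k i = 0)) = (of_bool (\<forall>i<d. k i = 0) :: complex)"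
    by (induction d) (auto simp: less_Suc_eq)
  ultimately show ?thesis by (simp add: has_bochner_integral_iff)
qed

lemma box_char_mult_cnj:
  "box_char d k u * cnj (box_char d l u) = box_char d (\<lambda>i. k i - l i) u"
  unfolding box_char_def cnj_prod prod.distrib[symmetric]
  by (intro prod.cong refl)
     (auto simp: indicator_def e_char_mult_cnj right_diff_distrib)

section \<open>Coinciding frequencies and quasi-orthogonality\<close>

lemma card_poly_level_le_degree:
  fixes p :: "int poly"
  assumes "degree p > 0" "finite A"
  shows "card {m \<in> A. poly p (int m) = c} \<le> degree p"
proof -
  define r where "r = p + [:- c:]"
  have deg: "degree r = degree p"
    unfolding r_def using assms(1) by (intro degree_add_eq_left) simp
  then have "r \<noteq> 0" using assms(1) by auto
  have "card {m \<in> A. poly p (int m) = c} = card (int ` {m \<in> A. poly p (int m) = c})"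
    by (simp add: card_image)
  also have "\<dots> \<le> card {x. poly r x = 0}"
    using \<open>r \<noteq> 0\<close> by (intro card_mono poly_roots_finite) (auto simp: r_def)
  also have "\<dots> \<le> degree r"
    using \<open>r \<noteq> 0\<close> by (rule card_poly_roots_bound)
  finally show ?thesis by (simp add: deg)
qed

text \<open>A Schur test: the arithmetic-geometric mean inequality splits each product into two
  halves, the symmetry of \<open>R\<close> makes their totals equal, and every row has at most
  \<open>D\<close> related indices.\<close>

lemma sum_norm_coincidence_le:
  fixes a :: "nat \<Rightarrow> complex" and R :: "nat \<Rightarrow> nat \<Rightarrow> bool"
  assumes "finite A" and sym: "\<And>n m. R n m \<longleftrightarrow> R m n"
    and card: "\<And>n. card {m \<in> A. R n m} \<le> D"
  shows "(\<Sum>n\<in>A. \<Sum>m\<in>A. norm (a n) * norm (a m) * of_bool (R n m)) \<le> (\<Sum>n\<in>A. real D * (norm (a n))\<^sup>2)"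
proof -
  let ?h = "\<lambda>n m. (norm (a n))\<^sup>2 / 2 * of_bool (R n m)"
  have "(\<Sum>n\<in>A. \<Sum>m\<in>A. norm (a n) * norm (a m) * of_bool (R n m)) \<le> (\<Sum>n\<in>A. \<Sum>m\<in>A. ?h n m + ?h m n)"
  proof (intro sum_mono)
    fix n m
    show "norm (a n) * norm (a m) * of_bool (R n m) \<le> ?h n m + ?h m n"
      using sum_squares_bound[of "norm (a n)" "norm (a m)"] sym[of n m] by auto
  qed
  also have "\<dots> = (\<Sum>n\<in>A. \<Sum>m\<in>A. ?h n m) + (\<Sum>n\<in>A. \<Sum>m\<in>A. ?h m n)"
    by (simp add: sum.distrib)
  also have "(\<Sum>n\<in>A. \<Sum>m\<in>A. ?h m n) = (\<Sum>n\<in>A. \<Sum>m\<in>A. ?h n m)"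
    by (rule sum.swap)
  also have "(\<Sum>n\<in>A. \<Sum>m\<in>A. ?h n m) = (\<Sum>n\<in>A. (norm (a n))\<^sup>2 / 2 * card {m \<in> A. R n m})"
    using \<open>finite A\<close> by (simp only: sum_distrib_left[symmetric] sum_of_bool_eq Int_def mem_Collect_eq)
  also have "\<dots> + \<dots> = (\<Sum>n\<in>A. (norm (a n))\<^sup>2 * card {m \<in> A. R n m})"
    by (simp flip: sum.distrib)
  also have "\<dots> \<le> (\<Sum>n\<in>A. (norm (a n))\<^sup>2 * real D)"
    by (intro sum_mono mult_left_mono) (use card in auto)
  finally show ?thesis by (simp add: mult.commute)
qed

text \<open>After expanding the square, only pairs with the same frequency vector survive
  integration, and each index has at most \<open>D\<close> such partners.\<close>

lemma box_char_quasi_orthogonal: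
  fixes a :: "nat \<Rightarrow> complex" and k :: "nat \<Rightarrow> nat \<Rightarrow> int"
  assumes "finite A" "\<And>n. card {m \<in> A. \<forall>i<d. k n i = k m i} \<le> D"
  shows "(\<integral>\<^sup>+u. ennreal ((norm (\<Sum>n\<in>A. a n * box_char d (k n) u))\<^sup>2) \<partial>PiM {..<d} (\<lambda>_. lborel))
    \<le> ennreal (\<Sum>n\<in>A. real D * (norm (a n))\<^sup>2)"
proof -
  let ?M = "PiM {..<d} (\<lambda>_. lborel) :: (nat \<Rightarrow> real) measure"
  let ?F = "\<lambda>u. \<Sum>n\<in>A. a n * box_char d (k n) u"
  define J :: complex where
    "J = (\<Sum>n\<in>A. \<Sum>m\<in>A. a n * cnj (a m) * of_bool (\<forall>i<d. k n i - k m i = 0))"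
  have "complex_of_real ((norm (?F u))\<^sup>2) =
      (\<Sum>n\<in>A. \<Sum>m\<in>A. a n * cnj (a m) * box_char d (\<lambda>i. k n i - k m i) u)" for u
    unfolding complex_norm_square cnj_sum sum_product
    by (simp flip: box_char_mult_cnj add: mult_ac)
  moreover have "has_bochner_integral ?M
      (\<lambda>u. \<Sum>n\<in>A. \<Sum>m\<in>A. a n * cnj (a m) * box_char d (\<lambda>i. k n i - k m i) u) J"
    unfolding J_def
    by (intro has_bochner_integral_sum has_bochner_integral_mult_right has_bochner_integral_box_char)
  \<comment> \<open>The square expands as a product with a conjugate only over the complex numbers;
    the next steps carry integrability and the value back to the reals.\<close>
  ultimately have hb: "has_bochner_integral ?M (\<lambda>u. complex_of_real ((norm (?F u))\<^sup>2)) J"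
    by simp
  then have int: "integrable ?M (\<lambda>u. (norm (?F u))\<^sup>2)"
    unfolding has_bochner_integral_iff complex_of_real_integrable_eq by blast
  have J: "complex_of_real (\<integral>u. (norm (?F u))\<^sup>2 \<partial>?M) = J"
    using has_bochner_integral_integral_eq[OF hb] unfolding integral_complex_of_real .
  have "(\<integral>u. (norm (?F u))\<^sup>2 \<partial>?M) \<le> norm J"
    unfolding J[symmetric] norm_of_real by (intro abs_ge_self)
  also have "norm J \<le> (\<Sum>n\<in>A. \<Sum>m\<in>A. norm (a n) * norm (a m) * of_bool (\<forall>i<d. k n i = k m i))"
    unfolding J_def by (intro sum_norm_le) (auto simp: norm_mult)
  also have "\<dots> \<le> (\<Sum>n\<in>A. real D * (norm (a n))\<^sup>2)"
    by (rule sum_norm_coincidence_le) (use assms in auto)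
  finally show ?thesis
    by (subst nn_integral_eq_integral[OF int]) (auto intro: ennreal_leI)
qed

section \<open>Application to polynomial phases\<close>

theorem corollary2p2:
  fixes d :: nat and \<phi> :: "nat \<Rightarrow> int poly" and a :: "nat \<Rightarrow> complex"
  assumes "d \<ge> 2"
    and "inj_on \<phi> {..<d}"
    and "\<And>i. i < d \<Longrightarrow> degree (\<phi> i) > 0"
    and "wronskian d \<phi> \<noteq> 0"
    and "\<And>\<epsilon>::real. \<epsilon> > 0 \<Longrightarrow> \<forall>\<^sub>F n in sequentially. norm (a n) \<le> real n powr \<epsilon>"
  shows "AE u in lebesgue_space d. u \<in> {..<d} \<rightarrow>\<^sub>E {0..<1} \<longrightarrow>
           (\<forall>\<epsilon>>0. \<forall>\<^sub>F N in sequentially. norm (weyl_sum d \<phi> a u N) \<le> real N powr (1 / 2 + \<epsilon>))"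
proof -
  let ?M = "PiM {..<d} (\<lambda>_. lborel) :: (nat \<Rightarrow> real) measure"
  define k where "k n i = poly (\<phi> i) (int n)" for n i
  \<comment> \<open>Equal frequency vectors agree in coordinate 0, so the degree of the nonconstant
    \<open>\<phi> 0\<close> bounds the multiplicity.\<close>
  define D where "D = degree (\<phi> 0)"
  \<comment> \<open>The general estimate sums from 0 and the Weyl sum from 1; a zero coefficient at
    0 reconciles them.\<close>
  define b where "b = a(0 := 0)"
  have card: "card {m \<in> A. \<forall>i<d. k n i = k m i} \<le> D" if "finite A" for A n
  proof -
    have "card {m \<in> A. \<forall>i<d. k n i = k m i} \<le> card {m \<in> A. poly (\<phi> 0) (int m) = k n 0}"
      using assms(1) that by (intro card_mono) (auto simp: k_def)
    also have "\<dots> \<le> D"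
      unfolding D_def using assms(1,3) that by (intro card_poly_level_le_degree) auto
    finally show ?thesis .
  qed
  have B: "(\<lambda>n. real D * (norm (b n))\<^sup>2) \<in> O(\<lambda>n. real n powr \<delta>)" if "\<delta> > 0" for \<delta>
  proof (rule bigoI)
    show "\<forall>\<^sub>F n in sequentially. norm (real D * (norm (b n))\<^sup>2) \<le> real D * norm (real n powr \<delta>)"
      \<comment> \<open>The exponent is halved because the coefficients get squared; positive
        \<open>n\<close> ensures \<open>b n = a n\<close>.\<close>
      using assms(5)[OF half_gt_zero[OF that]] eventually_gt_at_top[of 0]
    proof eventually_elim
      case (elim n)
      have "(norm (a n))\<^sup>2 \<le> (real n powr (\<delta> / 2))\<^sup>2"
        using elim that by (intro power_mono) auto
      also have "\<dots> = real n powr \<delta>" by (simp add: power2_eq_square flip: powr_add)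
      finally show ?case using elim by (auto simp: b_def intro!: mult_left_mono)
    qed
  qed
  have "AE u in ?M. \<forall>\<^sub>F N in sequentially.
      norm (\<Sum>n\<le>N. b n * box_char d (k n) u) \<le> real N powr (1 / 2 + \<epsilon>)" if "\<epsilon> > 0" for \<epsilon>
  proof (rule AE_partial_sums_le_powr[where B = "\<lambda>n. real D * (norm (b n))\<^sup>2"])
    show "(\<integral>\<^sup>+u. ennreal ((norm (\<Sum>n\<in>A. b n * box_char d (k n) u))\<^sup>2) \<partial>?M)
        \<le> ennreal (\<Sum>n\<in>A. real D * (norm (b n))\<^sup>2)" if "finite A" for A
      using that card by (intro box_char_quasi_orthogonal)
  qed (use B that in auto)
  \<comment> \<open>Only the countably many values \<open>1 / (m + 1)\<close> of \<epsilon> are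
    used, so one null set serves for all of them; every positive \<epsilon> exceeds one of these
    values.\<close>
  then have "AE u in ?M. \<forall>m. \<forall>\<^sub>F N in sequentially.
      norm (\<Sum>n\<le>N. b n * box_char d (k n) u) \<le> real N powr (1 / 2 + 1 / real (Suc m))"
    by (simp add: AE_all_countable)
  then have "AE u in ?M. u \<in> {..<d} \<rightarrow>\<^sub>E {0..<1} \<longrightarrow>
      (\<forall>\<epsilon>>0. \<forall>\<^sub>F N in sequentially. norm (weyl_sum d \<phi> a u N) \<le> real N powr (1 / 2 + \<epsilon>))"
  proof (rule AE_mp, intro AE_I2 impI allI)
    fix u and \<epsilon> :: real
    assume ev: "\<forall>m. \<forall>\<^sub>F N in sequentially.
        norm (\<Sum>n\<le>N. b n * box_char d (k n) u) \<le> real N powr (1 / 2 + 1 / real (Suc m))"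
      and u: "u \<in> {..<d} \<rightarrow>\<^sub>E {0..<1}" and "\<epsilon> > 0"
    obtain m where m: "1 / real (Suc m) < \<epsilon>"
      using \<open>\<epsilon> > 0\<close> nat_approx_posE by blast
    have "u i \<in> {0..1}" if "i < d" for i
      using PiE_mem[OF u, of i] that by auto
    \<comment> \<open>On the cube every indicator equals 1, so the cut-off character is the plain
      exponential.\<close>
    then have box: "box_char d (k n) u = e_char (\<Sum>i<d. u i * real_of_int (k n i))" for n
      unfolding box_char_def e_char_sum by (intro prod.cong) auto
    have weyl: "weyl_sum d \<phi> a u N = (\<Sum>n\<le>N. b n * box_char d (k n) u)" for N
    proof -
      have "(\<Sum>n\<le>N. b n * box_char d (k n) u) = (\<Sum>n=1..N. b n * box_char d (k n) u)"
        by (rule sum.mono_neutral_right) (auto simp: b_def)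
      also have "\<dots> = weyl_sum d \<phi> a u N"
        unfolding weyl_sum_def box by (intro sum.cong) (auto simp: b_def k_def)
      finally show ?thesis ..
    qed
    show "\<forall>\<^sub>F N in sequentially. norm (weyl_sum d \<phi> a u N) \<le> real N powr (1 / 2 + \<epsilon>)"
      using ev[rule_format, of m] eventually_ge_at_top[of 1]
    proof eventually_elim
      case (elim N)
      have "real N powr (1 / 2 + 1 / real (Suc m)) \<le> real N powr (1 / 2 + \<epsilon>)"
        using m elim(2) by (intro powr_mono) auto
      then show ?case using elim(1) unfolding weyl by linarith
    qed
  qed
  then show ?thesis
    unfolding lebesgue_space_def by (rule AE_completion)
qed

end
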